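(* Let $A$ be a unital $C^*$-algebra with unit $I$ and let $H$ be a Hilbert $A$-module. Suppose that $\{e_n\}_{n=0}^{\infty}\subseteq H$ is a stationary sequence that generates $H$ and that $\langle e_0,e_0\rangle=I$. Define $\{c_n\}_{n=0}^\infty\subseteq A$ by $c_0=I$ and $c_n=-\sum_{j=0}^{n-1}c_j\langle e_0,e_{n-j}\rangle$ for $n\ge 1$. Then $\{e_n\}_{n=0}^{\infty}$ is effective if and only if for all $k>0$, $$\langle e_k,e_0\rangle\Big(\sum_{n=1}^{\infty}c_nc_n^{*}\Big)\langle e_0,e_k\rangle=\langle e_k,e_0\rangle\langle e_0,e_k\rangle,$$ where the left-hand side means the limit in the norm of $A$, as $N\to\infty$, of $\langle e_k,e_0\rangle\big(\sum_{n=1}^{N}c_nc_n^{*}\big)\langle e_0,e_k\rangle$.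
   Context: A Hilbert $A$-module ($A$ a unital $C^*$-algebra) is a complex vector space and left $A$-module $H$ with an inner product $\langle\cdot,\cdot\rangle:H\times H\to A$ such that $\langle x,x\rangle\ge 0$ with equality iff $x=0$, $\langle x,y\rangle=\langle y,x\rangle^*$, and $\langle ax+by,z\rangle=a\langle x,z\rangle+b\langle y,z\rangle$ for $a,b\in A$, and which is complete in the norm $\|x\|=\sqrt{\|\langle x,x\rangle\|_A}$. A sequence $\{e_n\}_{n=0}^\infty$ generates $H$ if the finite $A$-linear combinations of its elements are dense in $H$. It is stationary if there is an $A$-linear isometry $T:H\to H$ with $T^ne_0=e_n$ for all $n$ (such a $T$ is known to preserve the $A$-valued inner product, by a theorem of Blecher; hence $\langle e_n,e_n\rangle=I$ for all $n$ when $\langle e_0,e_0\rangle=I$). A sequence $\{e_n\}_{n=0}^\infty\subseteq H$ with $\langle e_n,e_n\rangle=I$ for all $n$ is called effective if for every $x\in H$ the sequence defined by $x_0=\langle x,e_0\rangle e_0$ and $x_n=x_{n-1}+\langle x-x_{n-1},e_n\rangle e_n$ for $n\ge1$ converges to $x$ in norm. *)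

theory Defs
  imports Complex_Main
begin

section \<open>Unital C*-algebras\<close>

text \<open>
  The class \<open>real_normed_algebra_1\<close> demands \<open>norm 1 = 1\<close>; combining
  \<open>real_normed_algebra\<close> with \<open>monoid_mult\<close> instead keeps the zero algebra.
\<close>

class unital_cstar_algebra = real_normed_algebra + banach + monoid_mult +
  fixes scaleC :: "complex \<Rightarrow> 'a \<Rightarrow> 'a"
    and star :: "'a \<Rightarrow> 'a"
  assumes scaleC_add_right: "scaleC z (a + b) = scaleC z a + scaleC z b"
    and scaleC_add_left: "scaleC (z + w) a = scaleC z a + scaleC w a"
    and scaleC_scaleC: "scaleC z (scaleC w a) = scaleC (z * w) a"
    and scaleR_eq_scaleC: "scaleR r a = scaleC (complex_of_real r) a"
    and mult_scaleC_left: "scaleC z a * b = scaleC z (a * b)"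
    and mult_scaleC_right: "a * scaleC z b = scaleC z (a * b)"
    and norm_scaleC: "norm (scaleC z a) = cmod z * norm a"
    and star_add: "star (a + b) = star a + star b"
    and star_scaleC: "star (scaleC z a) = scaleC (cnj z) (star a)"
    and star_mult: "star (a * b) = star b * star a"
    and star_star: "star (star a) = a"
    and norm_star_mult_self: "norm (star a * a) = (norm a)\<^sup>2"

definition cstar_spectrum :: "'a::unital_cstar_algebra \<Rightarrow> complex set" where
  "cstar_spectrum a =
     {z. \<not> (\<exists>b. (scaleC z 1 - a) * b = 1 \<and> b * (scaleC z 1 - a) = 1)}"

definition cstar_nonneg :: "'a::unital_cstar_algebra \<Rightarrow> bool" where
  "cstar_nonneg a \<longleftrightarrow> star a = a \<and> cstar_spectrum a \<subseteq> complex_of_real ` {0..}"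

section \<open>Hilbert modules\<close>

text \<open>
  In the following, \<open>act\<close> is the left action of the algebra on the module and \<open>ip\<close> the
  algebra-valued inner product, which is linear in its first argument.
\<close>

definition module_norm :: "('h \<Rightarrow> 'h \<Rightarrow> 'a::unital_cstar_algebra) \<Rightarrow> 'h \<Rightarrow> real" where
  "module_norm ip x = sqrt (norm (ip x x))"

definition module_tendsto ::
    "('h::ab_group_add \<Rightarrow> 'h \<Rightarrow> 'a::unital_cstar_algebra) \<Rightarrow> (nat \<Rightarrow> 'h) \<Rightarrow> 'h \<Rightarrow> bool" where
  "module_tendsto ip X x \<longleftrightarrow> (\<lambda>n. module_norm ip (X n - x)) \<longlonglongrightarrow> 0"

definition module_Cauchy ::
    "('h::ab_group_add \<Rightarrow> 'h \<Rightarrow> 'a::unital_cstar_algebra) \<Rightarrow> (nat \<Rightarrow> 'h) \<Rightarrow> bool" where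
  "module_Cauchy ip X \<longleftrightarrow>
     (\<forall>\<epsilon>>0. \<exists>M. \<forall>m\<ge>M. \<forall>n\<ge>M. module_norm ip (X m - X n) < \<epsilon>)"

text \<open>
  The library locale \<open>module\<close> is restricted to commutative rings, so the axioms of the
  algebra action are listed here. The axioms \<open>act_scaleC\<close> and \<open>act_scale\<close> are the usual
  compatibility of the action with the complex scalars.
\<close>

locale hilbert_module = vector_space scale
  for scale :: "complex \<Rightarrow> 'h::ab_group_add \<Rightarrow> 'h" +
  fixes act :: "'a::unital_cstar_algebra \<Rightarrow> 'h \<Rightarrow> 'h"
    and ip :: "'h \<Rightarrow> 'h \<Rightarrow> 'a"
  assumes act_add_right: "act a (x + y) = act a x + act a y"
    and act_add_left: "act (a + b) x = act a x + act b x"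
    and act_act: "act a (act b x) = act (a * b) x"
    and act_one: "act 1 x = x"
    and act_scaleC: "act (scaleC z a) x = scale z (act a x)"
    and act_scale: "act a (scale z x) = scale z (act a x)"
    and ip_nonneg: "cstar_nonneg (ip x x)"
    and ip_self_eq_0_iff: "ip x x = 0 \<longleftrightarrow> x = 0"
    and ip_commute: "ip x y = star (ip y x)"
    and ip_linear_left: "ip (act a x + act b y) u = a * ip x u + b * ip y u"
    and complete: "module_Cauchy ip X \<Longrightarrow> \<exists>x. module_tendsto ip X x"

section \<open>Generating, stationary and effective sequences\<close>

definition generates ::
    "('a::unital_cstar_algebra \<Rightarrow> 'h::ab_group_add \<Rightarrow> 'h) \<Rightarrow> ('h \<Rightarrow> 'h \<Rightarrow> 'a) \<Rightarrow> (nat \<Rightarrow> 'h) \<Rightarrow> bool"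
  where
  "generates act ip e \<longleftrightarrow>
     (\<forall>x. \<forall>\<epsilon>>0. \<exists>F a. finite F \<and> module_norm ip (x - (\<Sum>n\<in>F. act (a n) (e n))) < \<epsilon>)"

definition stationary ::
    "('a::unital_cstar_algebra \<Rightarrow> 'h::ab_group_add \<Rightarrow> 'h) \<Rightarrow> ('h \<Rightarrow> 'h \<Rightarrow> 'a) \<Rightarrow> (nat \<Rightarrow> 'h) \<Rightarrow> bool"
  where
  "stationary act ip e \<longleftrightarrow>
     (\<exists>T. (\<forall>a b x y. T (act a x + act b y) = act a (T x) + act b (T y)) \<and>
          (\<forall>x. module_norm ip (T x) = module_norm ip x) \<and>
          (\<forall>n. (T ^^ n) (e 0) = e n))"

primrec kaczmarz ::
    "('a::unital_cstar_algebra \<Rightarrow> 'h::ab_group_add \<Rightarrow> 'h) \<Rightarrow> ('h \<Rightarrow> 'h \<Rightarrow> 'a) \<Rightarrow> (nat \<Rightarrow> 'h) \<Rightarrow>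
      'h \<Rightarrow> nat \<Rightarrow> 'h" where
  "kaczmarz act ip e x 0 = act (ip x (e 0)) (e 0)"
| "kaczmarz act ip e x (Suc n) =
     kaczmarz act ip e x n + act (ip (x - kaczmarz act ip e x n) (e (Suc n))) (e (Suc n))"

definition effective ::
    "('a::unital_cstar_algebra \<Rightarrow> 'h::ab_group_add \<Rightarrow> 'h) \<Rightarrow> ('h \<Rightarrow> 'h \<Rightarrow> 'a) \<Rightarrow> (nat \<Rightarrow> 'h) \<Rightarrow> bool"
  where
  "effective act ip e \<longleftrightarrow>
     (\<forall>n. ip (e n) (e n) = 1) \<and> (\<forall>x. module_tendsto ip (kaczmarz act ip e x) x)"

end

theory Submission
  imports Defs "HOL-Analysis.Topology_Euclidean_Space"
begin

text \<open>
  Let \<open>r\<^sub>n x\<close> be what is left of \<open>x\<close> after the first \<open>n\<close> steps of the Kaczmarz algorithm, that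
  is, after successively removing the components along \<open>e\<^sub>0, \<dots>, e\<^sub>n\<^sub>-\<^sub>1\<close>. Effectiveness says that
  \<open>r\<^sub>n x \<rightarrow> 0\<close> for all \<open>x\<close>. Each \<open>r\<^sub>n\<close> is an \<open>A\<close>-linear contraction, so it suffices to have this
  for the generators \<open>x = e\<^sub>k\<close> (\<open>residuals_vanish_if_on_generators\<close>).

  Let \<open>h\<^sub>n\<close> be what is left of \<open>e\<^sub>0\<close> after removing the components along \<open>e\<^sub>1, \<dots>, e\<^sub>n\<close>. Since the
  isometry \<open>T\<close> shifts the sequence and preserves inner products,
  \<open>r\<^sub>n\<^sub>+\<^sub>1 (T x) = T (r\<^sub>n x) - \<langle>T x, e\<^sub>0\<rangle> h\<^sub>n\<close> (\<open>residual_isometry_step\<close>). Applied to \<open>x = e\<^sub>k\<close> and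
  starting from \<open>r\<^sub>n e\<^sub>0 = 0\<close> for \<open>n \<ge> 1\<close>, this shows that the sequence is effective if and only if
  \<open>\<langle>e\<^sub>k, e\<^sub>0\<rangle> h\<^sub>n \<rightarrow> 0\<close> for every \<open>k > 0\<close> (\<open>residuals_vanish_iff_defect\<close>).

  The Gram matrix is Toeplitz, and therefore the recursion for \<open>c\<close> is the one that the algorithm
  performs on \<open>e\<^sub>0\<close>: \<open>h\<^sub>n = \<Sum>j\<le>n. c\<^sub>j e\<^sub>j\<close> and \<open>\<langle>h\<^sub>n, h\<^sub>n\<rangle> = 1 - \<Sum>j=1..n. c\<^sub>j c\<^sub>j\<^sup>*\<close>
  (\<open>defect_expansion\<close>, \<open>ip_defect\<close>). Hence the squared norm of \<open>\<langle>e\<^sub>k, e\<^sub>0\<rangle> h\<^sub>n\<close> is the distance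
  between the \<open>n\<close>-th term of the stated sequence and its stated limit.

  Two facts on C*-algebras are used. The norm is monotone on positive elements
  (\<open>nonneg_norm_mono\<close>), which makes the \<open>r\<^sub>n\<close> contractions and yields a weak triangle inequality.
  And positive \<open>p, q\<close> with \<open>norm (a p a\<^sup>*) = norm (a q a\<^sup>*)\<close> for all \<open>a\<close> are equal
  (\<open>nonneg_eq_if_conjugate_norms_eq\<close>), which is the core of Blecher's theorem that \<open>T\<close> preserves
  inner products (\<open>isometry_preserves_ip\<close>). As positivity is defined by the spectrum, both rest on
  the fact that a self-adjoint element attains its norm on its spectrum
  (\<open>selfadjoint_norm_attained\<close>).
\<close>

section \<open>Elementary C*-algebra\<close>

lemma scaleC_zero_right [simp]: "scaleC z (0::'a::unital_cstar_algebra) = 0"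
  using scaleC_add_right[of z 0 0] by simp

lemma scaleC_zero_left [simp]: "scaleC 0 (a::'a::unital_cstar_algebra) = 0"
  using scaleC_add_left[of 0 0 a] by simp

lemma scaleC_one [simp]: "scaleC 1 (a::'a::unital_cstar_algebra) = a"
  using scaleR_eq_scaleC[of 1 a] by simp

lemma scaleC_minus_right: "scaleC z (- a) = - scaleC z (a::'a::unital_cstar_algebra)"
  using scaleC_add_right[of z a "- a"] by (simp add: eq_neg_iff_add_eq_0 add.commute)

lemma scaleC_minus_left: "scaleC (- z) a = - scaleC z (a::'a::unital_cstar_algebra)"
  using scaleC_add_left[of z "- z" a] by (simp add: eq_neg_iff_add_eq_0 add.commute)

lemma scaleC_diff_right: "scaleC z (a - b) = scaleC z a - scaleC z (b::'a::unital_cstar_algebra)"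
  using scaleC_add_right[of z a "- b"] by (simp add: scaleC_minus_right)

lemma scaleC_diff_left: "scaleC (z - w) a = scaleC z a - scaleC w (a::'a::unital_cstar_algebra)"
  using scaleC_add_left[of z "- w" a] by (simp add: scaleC_minus_left)

lemma star_zero [simp]: "star (0::'a::unital_cstar_algebra) = 0"
  using star_add[of 0 0] by simp

lemma star_minus: "star (- a) = - star (a::'a::unital_cstar_algebra)"
  using star_add[of a "- a"] by (simp add: eq_neg_iff_add_eq_0 add.commute)

lemma star_diff: "star (a - b) = star a - star (b::'a::unital_cstar_algebra)"
  using star_add[of a "- b"] by (simp add: star_minus)

lemma star_one [simp]: "star (1::'a::unital_cstar_algebra) = 1"
  by (metis mult_1_left mult_1_right star_mult star_star)

lemma star_scaleR: "star (r *\<^sub>R a) = r *\<^sub>R star (a::'a::unital_cstar_algebra)"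
  by (simp add: scaleR_eq_scaleC star_scaleC)

lemma norm_star: "norm (star a) = norm (a::'a::unital_cstar_algebra)"
proof -
  have *: "norm b \<le> norm (star b)" for b :: 'a
  proof (cases "norm b = 0")
    case False
    have "norm b * norm b \<le> norm (star b) * norm b"
      using norm_star_mult_self[of b] norm_mult_ineq[of "star b" b]
      by (simp add: power2_eq_square)
    then show ?thesis using False by (simp add: mult_le_cancel_right)
  qed simp
  show ?thesis using *[of a] *[of "star a"] by (simp add: star_star)
qed

lemma norm_square_selfadjoint:
  "star a = a \<Longrightarrow> norm (a * a) = (norm (a::'a::unital_cstar_algebra))\<^sup>2"
  using norm_star_mult_self[of a] by simp

lemma norm_one_cstar: "(1::'a::unital_cstar_algebra) \<noteq> 0 \<Longrightarrow> norm (1::'a) = 1"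
  using norm_square_selfadjoint[of "1::'a"] by (simp add: power2_eq_square)

lemma one_nonzero: "(a::'a::unital_cstar_algebra) \<noteq> 0 \<Longrightarrow> (1::'a) \<noteq> 0"
  by (metis mult_1_left mult_zero_left)

section \<open>Invertibility and the spectrum\<close>

definition mutual_inverse :: "'a::unital_cstar_algebra \<Rightarrow> 'a \<Rightarrow> bool" where
  "mutual_inverse a g \<longleftrightarrow> a * g = 1 \<and> g * a = 1"

definition invertible_elem :: "'a::unital_cstar_algebra \<Rightarrow> bool" where
  "invertible_elem a \<longleftrightarrow> (\<exists>g. mutual_inverse a g)"

lemma mem_spectrum_iff:
  "z \<in> cstar_spectrum a \<longleftrightarrow> \<not> invertible_elem (scaleC z 1 - a)"
  by (auto simp: cstar_spectrum_def invertible_elem_def mutual_inverse_def)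

lemma mutual_inverse_mult:
  assumes "mutual_inverse a g" "mutual_inverse b h"
  shows "mutual_inverse (a * b) (h * g)"
proof -
  have "a * b * (h * g) = a * (b * h) * g" "h * g * (a * b) = h * (g * a) * b"
    by (simp_all add: mult.assoc)
  then show ?thesis using assms by (simp add: mutual_inverse_def)
qed

lemma invertible_mult: "invertible_elem a \<Longrightarrow> invertible_elem b \<Longrightarrow> invertible_elem (a * b)"
  unfolding invertible_elem_def by (meson mutual_inverse_mult)

lemma mutual_inverse_sym: "mutual_inverse a g \<Longrightarrow> mutual_inverse g a"
  by (simp add: mutual_inverse_def)

lemma mutual_inverse_unique:
  assumes "mutual_inverse a g" "mutual_inverse a h" shows "g = h"
proof -
  have "g = g * (a * h)" using assms by (simp add: mutual_inverse_def)
  also have "\<dots> = (g * a) * h" by (simp add: mult.assoc)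
  also have "\<dots> = h" using assms by (simp add: mutual_inverse_def)
  finally show ?thesis .
qed

lemma invertible_scaleC:
  assumes "z \<noteq> 0" "invertible_elem a" shows "invertible_elem (scaleC z a)"
proof -
  obtain g where g: "a * g = 1" "g * a = 1"
    using assms(2) by (auto simp: invertible_elem_def mutual_inverse_def)
  have "mutual_inverse (scaleC z a) (scaleC (1 / z) g)"
    using assms(1) g
    by (simp add: mutual_inverse_def mult_scaleC_left mult_scaleC_right scaleC_scaleC)
  then show ?thesis by (auto simp: invertible_elem_def)
qed

lemma invertible_minus: "invertible_elem (- a) \<longleftrightarrow> invertible_elem a"
  using invertible_scaleC[of "-1" a] invertible_scaleC[of "-1" "- a"]
  by (auto simp: scaleC_minus_left scaleC_minus_right)

text \<open>
  The right and the left inverse are fixed points of the contractions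
  \<open>x \<mapsto> 1 + y x\<close> and \<open>x \<mapsto> 1 + x y\<close>.
\<close>
lemma invertible_one_minus:
  fixes y :: "'a::unital_cstar_algebra"
  assumes "norm y < 1" shows "invertible_elem (1 - y)"
proof -
  have "\<exists>!x. 1 + y * x = x"
  proof (rule banach_fix_type[of "norm y"])
    show "\<forall>u v. dist (1 + y * u) (1 + y * v) \<le> norm y * dist u v"
      by (simp add: dist_norm flip: right_diff_distrib) (simp add: norm_mult_ineq)
  qed (use assms in auto)
  then obtain g where g: "1 + y * g = g" by blast
  have "\<exists>!x. 1 + x * y = x"
  proof (rule banach_fix_type[of "norm y"])
    show "\<forall>u v. dist (1 + u * y) (1 + v * y) \<le> norm y * dist u v"
      by (simp add: dist_norm flip: left_diff_distrib) (metis mult.commute norm_mult_ineq)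
  qed (use assms in auto)
  then obtain h where h: "1 + h * y = h" by blast
  have r: "(1 - y) * g = 1" using g by (simp add: left_diff_distrib) (metis add_diff_cancel_right')
  have l: "h * (1 - y) = 1" using h by (simp add: right_diff_distrib) (metis add_diff_cancel_right')
  have "h = h * ((1 - y) * g)" using r by simp
  also have "\<dots> = g" using l by (simp add: mult.assoc[symmetric])
  finally show ?thesis using r l by (auto simp: invertible_elem_def mutual_inverse_def)
qed

lemma spectrum_norm_bound:
  assumes "z \<in> cstar_spectrum (a::'a::unital_cstar_algebra)" shows "cmod z \<le> norm a"
proof (rule ccontr)
  assume less: "\<not> cmod z \<le> norm a"
  then have z: "z \<noteq> 0" by auto
  have "norm (scaleC (1 / z) a) < 1"
    using less z by (simp add: norm_scaleC norm_divide divide_simps)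
  then have "invertible_elem (scaleC z (1 - scaleC (1 / z) a))"
    using z by (intro invertible_scaleC invertible_one_minus)
  then show False
    using assms z by (simp add: mem_spectrum_iff scaleC_diff_right scaleC_scaleC)
qed

lemma spectrum_shift:
  "z \<in> cstar_spectrum (a + scaleC w 1) \<longleftrightarrow> z - w \<in> cstar_spectrum a"
  by (simp add: mem_spectrum_iff scaleC_diff_left algebra_simps)

lemma spectrum_reflect:
  "z \<in> cstar_spectrum (scaleC w 1 - a) \<longleftrightarrow> w - z \<in> cstar_spectrum a"
proof -
  have "scaleC (w - z) 1 - a = - (scaleC z 1 - (scaleC w 1 - a))"
    by (simp add: scaleC_diff_left)
  then show ?thesis by (simp only: mem_spectrum_iff invertible_minus)
qed

section \<open>The spectral radius of a self-adjoint element\<close>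

lemma star_power: "star b = b \<Longrightarrow> star (b ^ n) = (b::'a::unital_cstar_algebra) ^ n"
  by (induction n) (auto simp: star_mult power_commutes)

lemma norm_power_two_power:
  assumes "star b = (b::'a::unital_cstar_algebra)"
  shows "norm (b ^ 2 ^ n) = norm b ^ 2 ^ n"
proof (induction n)
  case (Suc n)
  have "b ^ 2 ^ Suc n = b ^ 2 ^ n * b ^ 2 ^ n"
    by (simp add: mult_2 power_add)
  then have "norm (b ^ 2 ^ Suc n) = (norm (b ^ 2 ^ n))\<^sup>2"
    using norm_square_selfadjoint[of "b ^ 2 ^ n"] star_power[OF assms] by simp
  then show ?case using Suc by (simp add: mult_2 power_add power2_eq_square)
qed simp

text \<open>
  The partial fraction identity \<open>1/(1 - a\<^sup>2) = (1/(1 - a) + 1/(1 + a))/2\<close>.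
\<close>
lemma average_resolvents:
  assumes "mutual_inverse (1 - a) g" "mutual_inverse (1 + a) h"
  shows "mutual_inverse (1 - a * a) ((1 / 2) *\<^sub>R (g + h))"
proof -
  have f: "1 - a * a = (1 + a) * (1 - a)" "1 - a * a = (1 - a) * (1 + a)"
    by (simp_all add: algebra_simps)
  have g: "(1 - a) * g = 1" "g * (1 - a) = 1" and h: "(1 + a) * h = 1" "h * (1 + a) = 1"
    using assms by (auto simp: mutual_inverse_def)
  have "(1 - a * a) * g = 1 + a"
    unfolding f(1) by (simp add: mult.assoc g)
  moreover have "(1 - a * a) * h = 1 - a"
    unfolding f(2) by (simp add: mult.assoc h)
  moreover have "g * (1 - a * a) = 1 + a"
    unfolding f(2) by (simp add: mult.assoc[symmetric] g)
  moreover have "h * (1 - a * a) = 1 - a"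
    unfolding f(1) by (simp add: mult.assoc[symmetric] h)
  ultimately have e: "(1 - a * a) * (g + h) = 2 *\<^sub>R 1" "(g + h) * (1 - a * a) = 2 *\<^sub>R 1"
    by (simp_all add: distrib_left distrib_right scaleR_2)
  show ?thesis
    unfolding mutual_inverse_def
    by (simp only: mult_scaleR_left mult_scaleR_right e) simp
qed

lemma resolvent_identity:
  assumes "mutual_inverse (1 - scaleC v b) g" "mutual_inverse (1 - scaleC w b) h"
  shows "h - g = scaleC (w - v) (h * b * g)"
proof -
  have g: "(1 - scaleC v b) * g = 1" and h: "h * (1 - scaleC w b) = 1"
    using assms by (auto simp: mutual_inverse_def)
  have "h - g = h * ((1 - scaleC v b) * g) - (h * (1 - scaleC w b)) * g"
    by (simp add: g h)
  also have "\<dots> = h * ((1 - scaleC v b) - (1 - scaleC w b)) * g"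
    by (simp add: algebra_simps)
  also have "\<dots> = scaleC (w - v) (h * b * g)"
    by (simp add: scaleC_diff_left left_diff_distrib right_diff_distrib mult_scaleC_left mult_scaleC_right)
  finally show ?thesis .
qed

lemma resolvent_continuous_on:
  fixes b :: "'a::unital_cstar_algebra"
  assumes f: "\<And>w. w \<in> S \<Longrightarrow> mutual_inverse (1 - scaleC w b) (f w)"
    and b: "norm b \<le> 1"
  shows "continuous_on S f"
  unfolding continuous_on_iff
proof (intro ballI allI impI)
  fix v :: complex and \<epsilon> :: real
  assume v: "v \<in> S" and \<epsilon>: "0 < \<epsilon>"
  define M where "M = norm (f v) + 1"
  have M: "M > 0" "norm (f v) \<le> M" by (simp_all add: M_def add_nonneg_pos)
  \<comment> \<open>The first bound keeps \<open>norm (f w)\<close> below \<open>2 * M\<close>, the second then controls the difference.\<close>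
  define \<delta> where "\<delta> = min (1 / (2 * M)) (\<epsilon> / (4 * M\<^sup>2))"
  have "dist (f w) (f v) < \<epsilon>" if w: "w \<in> S" "dist w v < \<delta>" for w
  proof -
    have d: "cmod (w - v) < 1 / (2 * M)" "cmod (w - v) < \<epsilon> / (4 * M\<^sup>2)"
      using w by (auto simp: \<delta>_def dist_norm)
    have "norm (f w * b * f v) \<le> norm (f w) * norm b * norm (f v)"
      by (meson mult_right_mono norm_ge_zero norm_mult_ineq order_trans)
    also have "\<dots> \<le> norm (f w) * 1 * M"
      using b M by (intro mult_mono) auto
    finally have "norm (f w - f v) \<le> cmod (w - v) * (norm (f w) * M)"
      using resolvent_identity[OF f[OF v] f[OF w(1)]]
      by (simp add: norm_scaleC mult_left_mono)
    note diff = this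
    have "cmod (w - v) * (norm (f w) * M) \<le> 1 / (2 * M) * (norm (f w) * M)"
      using d M by (intro mult_right_mono) auto
    also have "\<dots> = norm (f w) / 2" using M by simp
    finally have "norm (f w - f v) \<le> norm (f w) / 2" using diff by simp
    then have "norm (f w) \<le> 2 * M"
      using norm_triangle_sub[of "f w" "f v"] M by linarith
    then have "cmod (w - v) * (norm (f w) * M) \<le> cmod (w - v) * (2 * M * M)"
      using M by (intro mult_left_mono mult_right_mono) auto
    also have "\<dots> \<le> \<epsilon> / (4 * M\<^sup>2) * (2 * M * M)"
      using d M by (intro mult_right_mono) auto
    also have "\<dots> = \<epsilon> / 2" using M by (simp add: power2_eq_square)
    finally show ?thesis using diff \<epsilon> by (simp add: dist_norm)
  qed
  moreover have "\<delta> > 0" using M \<epsilon> by (simp add: \<delta>_def)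
  ultimately show "\<exists>d>0. \<forall>x'\<in>S. dist x' v < d \<longrightarrow> dist (f x') (f v) < \<epsilon>" by blast
qed

text \<open>
  Since every unit complex number has a square root, the resolvents of \<open>b\<^sup>2\<close> on the unit circle
  are averages of two resolvents of \<open>b\<close>, and averaging does not enlarge the distance between the
  circles of radius \<open>1\<close> and \<open>\<rho>\<close>. Iterating the squaring keeps the same \<open>\<epsilon>\<close> for all
  powers \<open>b ^ 2 ^ n\<close>, while the smaller radius becomes \<open>\<rho> ^ 2 ^ n\<close>.
\<close>
lemma close_resolvents_square_average:
  fixes b :: "'a::unital_cstar_algebra"
  assumes "\<And>w. cmod w = 1 \<Longrightarrow> \<exists>g h. mutual_inverse (1 - scaleC w b) g \<and>
      mutual_inverse (1 - scaleC (of_real \<rho> * w) b) h \<and> norm (g - h) \<le> \<epsilon>"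
  shows "cmod w = 1 \<Longrightarrow> \<exists>g h. mutual_inverse (1 - scaleC w (b ^ 2 ^ n)) g \<and>
      mutual_inverse (1 - scaleC (of_real (\<rho> ^ 2 ^ n) * w) (b ^ 2 ^ n)) h \<and> norm (g - h) \<le> \<epsilon>"
proof (induction n arbitrary: w)
  case 0 then show ?case using assms by simp
next
  case (Suc n)
  define B where "B = b ^ 2 ^ n"
  define r where "r = \<rho> ^ 2 ^ n"
  have BB: "b ^ 2 ^ Suc n = B * B" and rr: "\<rho> ^ 2 ^ Suc n = r * r"
    by (simp_all add: B_def r_def mult_2 power_add)
  define v where "v = csqrt w"
  have vv: "v * v = w" by (metis v_def power2_csqrt power2_eq_square)
  have v1: "cmod v = 1"
    using Suc.prems by (metis norm_mult vv norm_ge_zero abs_of_nonneg power2_eq_square power2_eq_1_iff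
        real_sqrt_abs real_sqrt_one)
  obtain g h where g: "mutual_inverse (1 - scaleC v B) g"
      and h: "mutual_inverse (1 - scaleC (of_real r * v) B) h" and gh: "norm (g - h) \<le> \<epsilon>"
    using Suc.IH[of v] v1 by (auto simp: B_def r_def)
  obtain g' h' where g': "mutual_inverse (1 - scaleC (- v) B) g'"
      and h': "mutual_inverse (1 - scaleC (of_real r * - v) B) h'" and gh': "norm (g' - h') \<le> \<epsilon>"
    using Suc.IH[of "- v"] v1 unfolding B_def r_def by (metis norm_minus_cancel)
  have sq: "scaleC u B * scaleC u B = scaleC (u * u) (B * B)" for u
    by (simp add: mult_scaleC_left mult_scaleC_right scaleC_scaleC)
  have 1: "mutual_inverse (1 - scaleC w (B * B)) ((1 / 2) *\<^sub>R (g + g'))"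
    using average_resolvents[of "scaleC v B" g g'] g g' by (simp add: scaleC_minus_left sq vv)
  have rv: "of_real r * v * (of_real r * v) = of_real (r * r) * w"
    by (simp add: vv[symmetric])
  have 2: "mutual_inverse (1 - scaleC (of_real (r * r) * w) (B * B)) ((1 / 2) *\<^sub>R (h + h'))"
    using average_resolvents[of "scaleC (of_real r * v) B" h h'] h h'
    by (simp only: scaleC_minus_left sq rv mult_minus_right diff_minus_eq_add)
  have "norm ((1 / 2) *\<^sub>R (g + g') - (1 / 2) *\<^sub>R (h + h')) = norm ((g - h) + (g' - h')) / 2"
    by (simp flip: scaleR_diff_right) (simp add: algebra_simps)
  also have "\<dots> \<le> \<epsilon>" using gh gh' norm_triangle_ineq[of "g - h" "g' - h'"] by linarith
  finally show ?case using 1 2 unfolding BB rr by blast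
qed

text \<open>
  Inside the unit disc the resolvent exists because \<open>norm (w b) < 1\<close>. If it also existed on
  the circle, it would be uniformly continuous on the closed disc, so the resolvents at the radii \<open>1\<close> and \<open>\<rho>\<close> would be close, uniformly over
  the powers \<open>B = b ^ 2 ^ n\<close>. As \<open>\<rho> ^ 2 ^ n\<close> tends to \<open>0\<close>, the inverse at the smaller
  radius tends to \<open>1\<close>. Hence \<open>1 - B\<close> has an inverse close to \<open>1\<close>, which makes \<open>B\<close>
  small. But \<open>norm B = 1\<close> by the C*-identity.
\<close>
lemma selfadjoint_unit_resolvent_singular:
  fixes b :: "'a::unital_cstar_algebra"
  assumes sa: "star b = b" and nb: "norm b = 1"
  shows "\<exists>w. cmod w = 1 \<and> \<not> invertible_elem (1 - scaleC w b)"
proof (rule ccontr)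
  assume no: "\<nexists>w. cmod w = 1 \<and> \<not> invertible_elem (1 - scaleC w b)"
  define f where "f w = (SOME g. mutual_inverse (1 - scaleC w b) g)" for w
  have f: "mutual_inverse (1 - scaleC w b) (f w)" if "w \<in> cball 0 1" for w
  proof -
    have "invertible_elem (1 - scaleC w b)"
    proof (cases "cmod w = 1")
      case False
      then have "norm (scaleC w b) < 1" using that nb by (simp add: norm_scaleC)
      then show ?thesis by (rule invertible_one_minus)
    qed (use no in auto)
    then show ?thesis unfolding f_def invertible_elem_def by (rule someI_ex)
  qed
  have "uniformly_continuous_on (cball 0 1) f"
    using resolvent_continuous_on[of "cball 0 1" b f] f nb
    by (intro compact_uniformly_continuous) auto
  then obtain \<delta> where \<delta>: "\<delta> > 0"
    "\<And>u v. u \<in> cball 0 1 \<Longrightarrow> v \<in> cball 0 1 \<Longrightarrow> dist u v < \<delta> \<Longrightarrow> dist (f u) (f v) < 1 / 8"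
    unfolding uniformly_continuous_on_def by (metis zero_less_divide_1_iff zero_less_numeral)
  define \<rho> where "\<rho> = 1 - min \<delta> 1 / 2"
  have \<rho>: "0 < \<rho>" "\<rho> < 1" "1 - \<rho> < \<delta>" using \<delta> by (auto simp: \<rho>_def min_def field_simps)
  have close: "\<exists>g h. mutual_inverse (1 - scaleC w b) g \<and>
      mutual_inverse (1 - scaleC (of_real \<rho> * w) b) h \<and> norm (g - h) \<le> 1 / 8" if "cmod w = 1" for w
  proof (intro exI conjI)
    have m: "w \<in> cball 0 1" "of_real \<rho> * w \<in> cball 0 1" using that \<rho> by (auto simp: norm_mult)
    have "w - of_real \<rho> * w = of_real (1 - \<rho>) * w" by (simp add: algebra_simps)
    then have "cmod (w - of_real \<rho> * w) = cmod (of_real (1 - \<rho>)) * cmod w"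
      by (simp only: norm_mult)
    also have "\<dots> = 1 - \<rho>" using that \<rho> by (simp only: norm_of_real) simp
    finally have "dist w (of_real \<rho> * w) < \<delta>"
      using \<rho> by (simp add: dist_norm)
    then show "norm (f w - f (of_real \<rho> * w)) \<le> 1 / 8"
      using \<delta>(2)[OF m] by (simp add: dist_norm)
    show "mutual_inverse (1 - scaleC w b) (f w)"
      "mutual_inverse (1 - scaleC (of_real \<rho> * w) b) (f (of_real \<rho> * w))" using f m by auto
  qed
  obtain n where n: "\<rho> ^ n < 1 / 9"
    using real_arch_pow_inv[of "1 / 9" \<rho>] \<rho> by auto
  have "\<rho> ^ 2 ^ n \<le> \<rho> ^ n" using \<rho> by (intro power_decreasing) (auto simp: less_imp_le)
  then have small: "\<rho> ^ 2 ^ n < 1 / 9" using n by simp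
  define B where "B = b ^ 2 ^ n"
  have B1: "norm B = 1" using norm_power_two_power[OF sa] nb by (simp add: B_def)
  obtain g h where "mutual_inverse (1 - scaleC 1 B) g"
      and "mutual_inverse (1 - scaleC (of_real (\<rho> ^ 2 ^ n) * 1) B) h" and gh: "norm (g - h) \<le> 1 / 8"
    using close_resolvents_square_average[OF close, of 1 n] unfolding B_def by auto
  then have g: "(1 - B) * g = 1" and h: "(1 - \<rho> ^ 2 ^ n *\<^sub>R B) * h = 1"
    by (simp_all add: mutual_inverse_def scaleR_eq_scaleC)
  have one: "norm (1::'a) = 1" using norm_one_cstar one_nonzero[of b] nb by fastforce
  have "h - 1 = \<rho> ^ 2 ^ n *\<^sub>R (B * h)" using h by (simp add: algebra_simps)
  then have "norm (h - 1) \<le> \<rho> ^ 2 ^ n * norm h"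
    using norm_mult_ineq[of B h] B1 \<rho> by (simp add: mult_left_mono)
  also have "\<dots> \<le> 1 / 9 * norm h" using small by (intro mult_right_mono) auto
  finally have "norm (h - 1) \<le> 1 / 8"
    using norm_triangle_sub[of h 1] one by linarith
  then have g1: "norm (g - 1) \<le> 1 / 4" using gh norm_triangle_ineq[of "g - h" "h - 1"] by simp
  \<comment> \<open>From \<open>B * g = g - 1\<close>; it bounds \<open>norm B = 1\<close> by \<open>1 / 4 + 1 / 4\<close>.\<close>
  have "B = (g - 1) - B * (g - 1)" using g by (simp add: algebra_simps)
  then have "norm B \<le> norm (g - 1) + norm (B * (g - 1))"
    using norm_triangle_ineq4[of "g - 1" "B * (g - 1)"] by simp
  also have "norm (B * (g - 1)) \<le> norm (g - 1)" using norm_mult_ineq[of B "g - 1"] B1 by simp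
  finally show False using g1 B1 by linarith
qed

lemma selfadjoint_norm_attained:
  fixes a :: "'a::unital_cstar_algebra"
  assumes "star a = a" "a \<noteq> 0"
  shows "\<exists>z \<in> cstar_spectrum a. cmod z = norm a"
proof -
  define b where "b = (1 / norm a) *\<^sub>R a"
  have "star b = b" "norm b = 1" using assms by (auto simp: b_def star_scaleR)
  then obtain w where w: "cmod w = 1" "\<not> invertible_elem (1 - scaleC w b)"
    using selfadjoint_unit_resolvent_singular by blast
  define z where "z = of_real (norm a) / w"
  have w0: "w \<noteq> 0" and z0: "z \<noteq> 0" using w assms by (auto simp: z_def)
  have "scaleC z 1 - a = scaleC z (1 - scaleC w b)"
    using w0 assms by (simp add: scaleC_diff_right scaleC_scaleC b_def scaleR_eq_scaleC z_def)
  moreover have "scaleC (1 / z) (scaleC z (1 - scaleC w b)) = 1 - scaleC w b"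
    using z0 by (simp add: scaleC_scaleC)
  ultimately have "z \<in> cstar_spectrum a"
    using w z0 invertible_scaleC[of "1 / z" "scaleC z 1 - a"] by (auto simp: mem_spectrum_iff)
  moreover have "cmod z = norm a" using w by (simp add: z_def norm_divide)
  ultimately show ?thesis by blast
qed

text \<open>
  Shifting by \<open>\<i> t\<close> moves a point \<open>x + \<i> y\<close> of the spectrum to distance at least \<open>\<bar>y + t\<bar>\<close>
  from the origin, whereas the C*-identity bounds the squared norm of \<open>a + \<i> t\<close> by
  \<open>(norm a)\<^sup>2 + t\<^sup>2\<close>. For \<open>y \<noteq> 0\<close> the term \<open>2 y t\<close> breaks this bound for a suitable \<open>t\<close>.
\<close>
lemma selfadjoint_spectrum_real:
  fixes a :: "'a::unital_cstar_algebra"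
  assumes sa: "star a = a" and z: "z \<in> cstar_spectrum a"
  shows "Im z = 0"
proof (rule ccontr)
  assume y: "Im z \<noteq> 0"
  have bound: "(Im z + t)\<^sup>2 \<le> (norm a)\<^sup>2 * 1 + t\<^sup>2 * norm (1::'a)" for t
  proof -
    let ?d = "a + scaleC (Complex 0 t) 1"
    have "z + Complex 0 t \<in> cstar_spectrum ?d" using z by (simp add: spectrum_shift)
    then have "cmod (z + Complex 0 t) \<le> norm ?d" by (rule spectrum_norm_bound)
    then have "(cmod (z + Complex 0 t))\<^sup>2 \<le> (norm ?d)\<^sup>2" by (rule power_mono) simp
    also have "(norm ?d)\<^sup>2 = norm (star ?d * ?d)" by (simp add: norm_star_mult_self)
    also have "cnj (Complex 0 t) = - Complex 0 t" by (simp add: complex_eq_iff)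
    then have "star ?d * ?d = a * a - scaleC (Complex 0 t * Complex 0 t) 1"
      by (simp add: star_add star_scaleC sa scaleC_minus_left algebra_simps scaleC_diff_right
          mult_scaleC_left mult_scaleC_right scaleC_scaleC)
    also have "Complex 0 t * Complex 0 t = - of_real (t\<^sup>2)"
      by (simp add: complex_eq_iff power2_eq_square)
    also have "a * a - scaleC (- of_real (t\<^sup>2)) 1 = a * a + t\<^sup>2 *\<^sub>R 1"
      by (simp add: scaleC_minus_left scaleR_eq_scaleC)
    also have "norm \<dots> \<le> norm (a * a) + norm (t\<^sup>2 *\<^sub>R (1::'a))" by (rule norm_triangle_ineq)
    also have "\<dots> = (norm a)\<^sup>2 * 1 + t\<^sup>2 * norm (1::'a)"
      using norm_square_selfadjoint[OF sa] by simp
    finally have "(cmod (z + Complex 0 t))\<^sup>2 \<le> (norm a)\<^sup>2 * 1 + t\<^sup>2 * norm (1::'a)" .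
    moreover have "(Im z + t)\<^sup>2 \<le> (cmod (z + Complex 0 t))\<^sup>2" by (simp add: cmod_power2)
    ultimately show ?thesis by linarith
  qed
  have "norm (1::'a) \<le> 1" using norm_one_cstar[where 'a='a] by fastforce
  then have "t\<^sup>2 * norm (1::'a) \<le> t\<^sup>2" for t :: real by (simp add: mult_left_le)
  then have "(Im z + t)\<^sup>2 \<le> (norm a)\<^sup>2 + t\<^sup>2" for t :: real
    using bound[of t] by (smt (verit))
  then have b: "(Im z)\<^sup>2 + 2 * Im z * t \<le> (norm a)\<^sup>2" for t
    by (smt (verit) power2_sum)
  have "2 * Im z * (((norm a)\<^sup>2 + 1) / (2 * Im z)) = (norm a)\<^sup>2 + 1" using y by simp
  then show False using b[of "((norm a)\<^sup>2 + 1) / (2 * Im z)"] by (smt (verit) zero_le_power2)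
qed

lemma selfadjoint_spectrum_sign:
  fixes a :: "'a::unital_cstar_algebra"
  assumes "star a = a" "a \<noteq> 0"
  shows "of_real (norm a) \<in> cstar_spectrum a \<or> of_real (- norm a) \<in> cstar_spectrum a"
proof -
  obtain z where z: "z \<in> cstar_spectrum a" "cmod z = norm a"
    using selfadjoint_norm_attained[OF assms] by blast
  have z': "z = of_real (Re z)" using selfadjoint_spectrum_real[OF assms(1) z(1)]
    by (simp add: complex_eq_iff)
  then have "\<bar>Re z\<bar> = norm a" using z(2) by (metis norm_of_real)
  then show ?thesis using z z' by (metis abs_eq_iff abs_norm_cancel)
qed

section \<open>Norms of positive elements\<close>

lemma nonneg_selfadjoint: "cstar_nonneg a \<Longrightarrow> star a = a"
  by (simp add: cstar_nonneg_def)

lemma nonneg_spectrumE: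
  assumes "cstar_nonneg a" "z \<in> cstar_spectrum a"
  obtains m where "z = of_real m" "0 \<le> m" "m \<le> norm a"
proof -
  obtain m where m: "z = of_real m" "0 \<le> m" using assms by (auto simp: cstar_nonneg_def)
  with spectrum_norm_bound[OF assms(2)] show ?thesis by (intro that) auto
qed

text \<open>
  The spectrum of \<open>t - a\<close> lies in \<open>[0, t]\<close>, and a self-adjoint element attains its norm on
  the spectrum.
\<close>
lemma nonneg_norm_complement:
  fixes a :: "'a::unital_cstar_algebra"
  assumes a: "cstar_nonneg a" and t: "norm a \<le> t"
  shows "norm (t *\<^sub>R 1 - a) \<le> t"
proof (cases "t *\<^sub>R 1 - a = 0")
  case True
  then show ?thesis using order_trans[OF norm_ge_zero t] by simp
next
  case False
  have "star (t *\<^sub>R 1 - a) = t *\<^sub>R 1 - a"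
    by (simp add: star_diff star_scaleR nonneg_selfadjoint[OF a])
  from selfadjoint_norm_attained[OF this False] obtain z
    where z: "z \<in> cstar_spectrum (scaleC (of_real t) 1 - a)" "cmod z = norm (t *\<^sub>R 1 - a)"
    by (auto simp: scaleR_eq_scaleC)
  then obtain m where m: "of_real t - z = of_real m" "0 \<le> m" "m \<le> norm a"
    using nonneg_spectrumE[OF a] by (auto simp: spectrum_reflect)
  have "z = of_real (t - m)" using m(1) by (simp add: algebra_simps)
  then have "cmod z = \<bar>t - m\<bar>" by (metis norm_of_real)
  then show ?thesis using m t z by simp
qed

text \<open>
  Adding the scalar \<open>t = norm b\<close> to a positive \<open>a\<close> raises its norm by exactly \<open>t\<close>,
  because \<open>norm a\<close> lies in the spectrum. Writing \<open>a + t = (a + b) + (t - b)\<close> then gives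
  \<open>norm a + t \<le> norm (a + b) + t\<close>.
\<close>
lemma nonneg_norm_mono:
  fixes a b :: "'a::unital_cstar_algebra"
  assumes a: "cstar_nonneg a" and b: "cstar_nonneg b"
  shows "norm a \<le> norm (a + b)"
proof (cases "a = 0")
  case False
  obtain z where z: "z \<in> cstar_spectrum a" "cmod z = norm a"
    using selfadjoint_norm_attained[OF nonneg_selfadjoint[OF a] False] by blast
  then have za: "z = of_real (norm a)" using nonneg_spectrumE[OF a z(1)] by force
  let ?t = "norm b"
  have "of_real (norm a + ?t) \<in> cstar_spectrum (a + scaleC (of_real ?t) 1)"
    using z za by (simp add: spectrum_shift)
  then have "norm a + ?t \<le> norm (a + ?t *\<^sub>R 1)"
    using spectrum_norm_bound[of "of_real (norm a + ?t)" "a + ?t *\<^sub>R 1"]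
    by (simp only: scaleR_eq_scaleC norm_of_real) simp
  also have "a + ?t *\<^sub>R 1 = (a + b) + (?t *\<^sub>R 1 - b)" by simp
  also have "norm \<dots> \<le> norm (a + b) + ?t"
    using norm_triangle_ineq[of "a + b" "?t *\<^sub>R 1 - b"] nonneg_norm_complement[OF b order_refl]
    by linarith
  finally show ?thesis by simp
qed simp

section \<open>Positive elements are determined by the norms of their conjugates\<close>

text \<open>
  With \<open>s = 1 - u\<close> the equation \<open>s\<^sup>2 = 1 - y\<close> reads \<open>u = (y + u\<^sup>2)/2\<close>, and the right-hand side
  is a contraction of the ball of radius \<open>norm y\<close>. The involution maps fixed points to fixed
  points, so by uniqueness \<open>u\<close> is self-adjoint.
\<close>
lemma selfadjoint_sqrt_one_minus:
  fixes y :: "'a::unital_cstar_algebra"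
  assumes sa: "star y = y" and y: "norm y < 1"
  shows "\<exists>s. star s = s \<and> invertible_elem s \<and> s * s = 1 - y"
proof -
  let ?S = "cball (0::'a) (norm y)"
  define f where "f u = (1 / 2) *\<^sub>R (y + u * u)" for u
  have *: "\<exists>!u\<in>?S. f u = u"
  proof (rule Banach_fix[of _ "norm y"])
    show "complete ?S" "?S \<noteq> {}" by (auto simp: complete_eq_closed)
    show "f ` ?S \<subseteq> ?S"
    proof clarsimp
      fix u :: 'a assume u: "norm u \<le> norm y"
      have "norm (u * u) \<le> norm y * 1"
        using norm_mult_ineq[of u u] u y mult_mono[of "norm u" "norm y" "norm u" 1] by simp
      then show "norm (f u) \<le> norm y" using norm_triangle_ineq[of y "u * u"] by (simp add: f_def)
    qed
    fix u v :: 'a assume uv: "u \<in> ?S" "v \<in> ?S"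
    have "f u - f v = (1 / 2) *\<^sub>R (u * (u - v) + (u - v) * v)"
      by (simp add: f_def algebra_simps)
    then have "norm (f u - f v) \<le> (norm (u * (u - v)) + norm ((u - v) * v)) / 2"
      using norm_triangle_ineq[of "u * (u - v)" "(u - v) * v"] by simp
    also have "\<dots> \<le> (norm y * norm (u - v) + norm (u - v) * norm y) / 2"
      using uv by (intro divide_right_mono add_mono order_trans[OF norm_mult_ineq] mult_mono) auto
    finally show "dist (f u) (f v) \<le> norm y * dist u v" by (simp add: dist_norm)
  qed (use y in auto)
  then obtain u where u: "norm u \<le> norm y" "f u = u" by auto
  have "f (star u) = star (f u)" by (simp add: f_def star_scaleR star_add star_mult sa)
  then have "star u = u" using * u by (metis mem_cball_0 norm_star)
  moreover have "2 *\<^sub>R f u = y + u * u" by (simp add: f_def)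
  then have "(1 - u) * (1 - u) = 1 - y" using u by (simp add: algebra_simps scaleR_2)
  moreover have "invertible_elem (1 - u)" using u y by (intro invertible_one_minus) simp
  ultimately show ?thesis by (intro exI[of _ "1 - u"]) (simp add: star_diff)
qed

text \<open>
  The square root \<open>s\<close> of \<open>q + l\<close> and its inverse \<open>r\<close>, obtained after scaling by
  \<open>t = norm q + l\<close>: then \<open>(q + l)/t = 1 - y\<close> with \<open>norm y \<le> norm q/t < 1\<close>.
\<close>
lemma invertible_pos_shift:
  fixes q :: "'a::unital_cstar_algebra"
  assumes q: "cstar_nonneg q" and l: "0 < l"
  obtains s r where "star r = r" "mutual_inverse s r" "s * s = q + l *\<^sub>R 1"
proof -
  define t where "t = norm q + l"
  have t: "t > 0" using l by (simp add: t_def add_nonneg_pos)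
  define y where "y = (1 / t) *\<^sub>R (norm q *\<^sub>R 1 - q)"
  have "norm y \<le> norm q / t"
    using nonneg_norm_complement[OF q order_refl] t by (simp add: y_def divide_right_mono)
  also have "\<dots> < 1" using t l by (simp add: t_def)
  finally have "norm y < 1" .
  moreover have "star y = y" by (simp add: y_def star_scaleR star_diff nonneg_selfadjoint[OF q])
  ultimately obtain s where s: "star s = s" "invertible_elem s" "s * s = 1 - y"
    using selfadjoint_sqrt_one_minus by blast
  then obtain r where r: "mutual_inverse s r" by (auto simp: invertible_elem_def)
  have "mutual_inverse (star s) (star r)"
    using r by (metis mutual_inverse_def star_mult star_one)
  then have sr: "star r = r" using s(1) r mutual_inverse_unique by metis
  have "t *\<^sub>R (1 - y) = q + l *\<^sub>R 1"
    using t by (simp add: y_def scaleR_diff_right) (simp add: t_def algebra_simps)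
  then have "(sqrt t *\<^sub>R s) * (sqrt t *\<^sub>R s) = q + l *\<^sub>R 1"
    using t s by simp
  moreover have "mutual_inverse (sqrt t *\<^sub>R s) ((1 / sqrt t) *\<^sub>R r)"
    using r t by (simp add: mutual_inverse_def)
  moreover have "star ((1 / sqrt t) *\<^sub>R r) = (1 / sqrt t) *\<^sub>R r" by (simp add: star_scaleR sr)
  ultimately show ?thesis by (intro that)
qed

text \<open>
  Here \<open>r q r\<close> is the element \<open>q/(q + l)\<close>, whose spectrum consists of the numbers
  \<open>x/(x + l)\<close> with \<open>x\<close> in the spectrum of \<open>q\<close>. The proof follows this map backwards: a point
  \<open>z\<close> of the spectrum on which the norm is attained yields the point \<open>x = z l/(1 - z) \<ge> 0\<close>
  in the spectrum of \<open>q\<close>.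
\<close>
lemma conjugate_invertible_pos:
  fixes q :: "'a::unital_cstar_algebra"
  assumes q: "cstar_nonneg q" and l: "0 < l" and r: "star r = r"
    and sr: "mutual_inverse s r" and ss: "s * s = q + l *\<^sub>R 1"
  shows "norm (r * q * r) < 1"
proof (cases "r * q * r = 0")
  case False
  have "star (r * q * r) = r * q * r"
    by (simp add: star_mult r nonneg_selfadjoint[OF q] mult.assoc)
  from selfadjoint_norm_attained[OF this False] obtain z
    where z: "z \<in> cstar_spectrum (r * q * r)" "cmod z = norm (r * q * r)" by blast
  have rs: "r * s = 1" "s * r = 1" using sr by (auto simp: mutual_inverse_def)
  \<comment> \<open>Conjugation by the invertible \<open>r\<close> turns \<open>z - r q r\<close> into \<open>z (q + l) - q\<close>.\<close>
  have "r * (s * s) * r = 1" using rs by (metis mult.assoc mult_1_right)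
  then have "scaleC z 1 = r * scaleC z (s * s) * r" by (simp add: mult_scaleC_left mult_scaleC_right)
  then have "scaleC z 1 - r * q * r = r * (scaleC z (s * s) - q) * r" by (simp add: algebra_simps)
  moreover have "invertible_elem r" using sr mutual_inverse_sym invertible_elem_def by blast
  ultimately have "\<not> invertible_elem (scaleC z (s * s) - q)"
    using z(1) invertible_mult unfolding mem_spectrum_iff by metis
  moreover have "scaleC z (s * s) - q = scaleC (z * of_real l) 1 - scaleC (1 - z) q"
    by (simp add: ss scaleR_eq_scaleC scaleC_add_right scaleC_scaleC scaleC_diff_left)
  ultimately have ni: "\<not> invertible_elem (scaleC (z * of_real l) 1 - scaleC (1 - z) q)" by simp
  have z1: "z \<noteq> 1"
  proof
    assume "z = 1"
    moreover have "invertible_elem (1::'a)" by (auto simp: invertible_elem_def mutual_inverse_def)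
    ultimately show False using ni l invertible_scaleC[of "of_real l" "1::'a"] by simp
  qed
  define m where "m = z * of_real l / (1 - z)"
  have "scaleC (z * of_real l) 1 - scaleC (1 - z) q = scaleC (1 - z) (scaleC m 1 - q)"
    using z1 by (simp add: scaleC_diff_right scaleC_scaleC m_def)
  then have "m \<in> cstar_spectrum q"
    using ni invertible_scaleC[of "1 - z" "scaleC m 1 - q"] z1 by (auto simp: mem_spectrum_iff)
  then obtain x where x: "m = of_real x" "0 \<le> x" using nonneg_spectrumE[OF q] by metis
  have "z * of_real l = of_real x * (1 - z)" using x z1 by (simp add: m_def field_simps)
  then have "z * of_real (l + x) = of_real x" by (simp add: algebra_simps)
  then have "cmod z * \<bar>l + x\<bar> = \<bar>x\<bar>" by (metis norm_mult norm_of_real)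
  then have "cmod z = x / (l + x)" using x l by (simp add: field_simps)
  also have "\<dots> < 1" using x l by simp
  finally show ?thesis using z by simp
qed simp

text \<open>
  The element \<open>l - (p - q) = (q + l) - p\<close> equals \<open>s (1 - r p r) s\<close>, where \<open>s\<close> is the square
  root of \<open>q + l\<close> and \<open>r\<close> its inverse. It is invertible because \<open>norm (r p r) = norm (r q r) < 1\<close>.
\<close>
lemma pos_not_in_spectrum_diff:
  fixes p q :: "'a::unital_cstar_algebra"
  assumes q: "cstar_nonneg q" and l: "0 < l"
    and eq: "\<And>a. norm (a * p * star a) = norm (a * q * star a)"
  shows "of_real l \<notin> cstar_spectrum (p - q)"
proof -
  obtain s r where r: "star r = r" and sr: "mutual_inverse s r" and ss: "s * s = q + l *\<^sub>R 1"
    using invertible_pos_shift[OF q l] .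
  have "norm (r * p * r) < 1"
    using eq[of r] conjugate_invertible_pos[OF q l r sr ss] r by simp
  then have "invertible_elem (1 - r * p * r)" by (rule invertible_one_minus)
  moreover have "invertible_elem s" using sr by (auto simp: invertible_elem_def)
  ultimately have "invertible_elem (s * (1 - r * p * r) * s)" by (intro invertible_mult)
  moreover have "s * (r * p * r) * s = (s * r) * p * (r * s)" by (simp add: mult.assoc)
  then have "s * (1 - r * p * r) * s = scaleC (of_real l) 1 - (p - q)"
    using sr ss by (simp add: mutual_inverse_def left_diff_distrib right_diff_distrib scaleR_eq_scaleC)
  ultimately show ?thesis by (simp add: mem_spectrum_iff)
qed

text \<open>
  Neither \<open>p - q\<close> nor \<open>q - p\<close> has a positive point in its spectrum, whereas a nonzero
  self-adjoint element attains its norm, up to sign, on the spectrum.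
\<close>
lemma nonneg_eq_if_conjugate_norms_eq:
  fixes p q :: "'a::unital_cstar_algebra"
  assumes p: "cstar_nonneg p" and q: "cstar_nonneg q"
    and eq: "\<And>a. norm (a * p * star a) = norm (a * q * star a)"
  shows "p = q"
proof (rule ccontr)
  assume "p \<noteq> q"
  then have d: "p - q \<noteq> 0" "norm (p - q) > 0" by auto
  have "star (p - q) = p - q" by (simp add: star_diff nonneg_selfadjoint p q)
  from selfadjoint_spectrum_sign[OF this d(1)] show False
  proof
    assume "of_real (norm (p - q)) \<in> cstar_spectrum (p - q)"
    then show False using pos_not_in_spectrum_diff[OF q d(2) eq] by simp
  next
    assume "of_real (- norm (p - q)) \<in> cstar_spectrum (p - q)"
    then have "of_real (norm (p - q)) \<in> cstar_spectrum (q - p)"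
      using spectrum_reflect[of "of_real (norm (p - q))" 0 "p - q"] by simp
    then show False using pos_not_in_spectrum_diff[OF p d(2) eq[symmetric]] by simp
  qed
qed

section \<open>Module and inner product arithmetic\<close>

context hilbert_module
begin

lemma act_zero_left [simp]: "act 0 x = 0"
  using act_add_left[of 0 0 x] by simp

lemma act_zero_right [simp]: "act a 0 = 0"
  using act_add_right[of a 0 0] by simp

lemma act_minus_left: "act (- a) x = - act a x"
  using act_add_left[of a "- a" x] by (simp add: eq_neg_iff_add_eq_0 add.commute)

lemma act_minus_right: "act a (- x) = - act a x"
  using act_add_right[of a x "- x"] by (simp add: eq_neg_iff_add_eq_0 add.commute)

lemma act_diff_right: "act a (x - y) = act a x - act a y"
  using act_add_right[of a x "- y"] by (simp add: act_minus_right)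

lemma ip_add_left: "ip (x + y) z = ip x z + ip y z"
  using ip_linear_left[of 1 x 1 y z] by (simp add: act_one)

lemma ip_act_left: "ip (act a x) z = a * ip x z"
  using ip_linear_left[of a x 0 x z] by simp

lemma ip_add_right: "ip x (y + z) = ip x y + ip x z"
  by (metis ip_add_left ip_commute star_add)

lemma ip_act_right: "ip x (act a z) = ip x z * star a"
  by (metis ip_act_left ip_commute star_mult)

lemma ip_zero_left [simp]: "ip 0 z = 0"
  using ip_add_left[of 0 0 z] by simp

lemma ip_minus_left: "ip (- x) z = - ip x z"
  using ip_add_left[of x "- x" z] by (simp add: eq_neg_iff_add_eq_0 add.commute)

lemma ip_minus_right: "ip x (- z) = - ip x z"
  by (metis ip_commute ip_minus_left star_minus)

lemma ip_diff_left: "ip (x - y) z = ip x z - ip y z"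
  using ip_add_left[of x "- y" z] by (simp add: ip_minus_left)

lemma ip_diff_right: "ip x (y - z) = ip x y - ip x z"
  using ip_add_right[of x y "- z"] by (simp add: ip_minus_right)

lemma ip_sum_left: "ip (\<Sum>i\<in>F. f i) z = (\<Sum>i\<in>F. ip (f i) z)"
  by (induction F rule: infinite_finite_induct) (auto simp: ip_add_left)

lemma ip_act_act: "ip (act a x) (act a x) = a * ip x x * star a"
  by (simp add: ip_act_left ip_act_right mult.assoc)

section \<open>Convergence in a Hilbert module\<close>

definition sqnorm :: "'h \<Rightarrow> real" where "sqnorm x = norm (ip x x)"

lemma module_norm_eq_sqrt: "module_norm ip x = sqrt (sqnorm x)"
  by (simp add: module_norm_def sqnorm_def)

lemma sqnorm_nonneg [simp]: "0 \<le> sqnorm x"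
  by (simp add: sqnorm_def)

lemma sqnorm_zero [simp]: "sqnorm 0 = 0"
  by (simp add: sqnorm_def)

lemma sqnorm_minus: "sqnorm (- x) = sqnorm x"
  by (simp add: sqnorm_def ip_minus_left ip_minus_right)

lemma module_tendsto_iff_sqnorm: "module_tendsto ip X x \<longleftrightarrow> (\<lambda>n. sqnorm (X n - x)) \<longlonglongrightarrow> 0"
proof
  assume "module_tendsto ip X x"
  then have "(\<lambda>n. (sqrt (sqnorm (X n - x)))\<^sup>2) \<longlonglongrightarrow> 0\<^sup>2"
    unfolding module_tendsto_def module_norm_eq_sqrt by (rule tendsto_power)
  then show "(\<lambda>n. sqnorm (X n - x)) \<longlonglongrightarrow> 0" by simp
next
  assume "(\<lambda>n. sqnorm (X n - x)) \<longlonglongrightarrow> 0"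
  then show "module_tendsto ip X x"
    unfolding module_tendsto_def module_norm_eq_sqrt using tendsto_real_sqrt by force
qed

text \<open>
  The parallelogram law and monotonicity of the norm on positive elements yield a triangle
  inequality up to constants, which controls sums of sequences that tend to zero.
\<close>
lemma sqnorm_add: "sqnorm (x + y) \<le> 2 * sqnorm x + 2 * sqnorm y"
proof -
  have "sqnorm (x + y) \<le> norm (ip (x + y) (x + y) + ip (x - y) (x - y))"
    unfolding sqnorm_def by (intro nonneg_norm_mono ip_nonneg)
  also have "ip (x + y) (x + y) + ip (x - y) (x - y) = 2 *\<^sub>R ip x x + 2 *\<^sub>R ip y y"
    by (simp add: ip_add_left ip_add_right ip_diff_left ip_diff_right scaleR_2)
  also have "norm \<dots> \<le> 2 * sqnorm x + 2 * sqnorm y"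
    unfolding sqnorm_def by (rule order_trans[OF norm_triangle_ineq]) simp
  finally show ?thesis .
qed

lemma sqnorm_act: "sqnorm (act a x) \<le> (norm a)\<^sup>2 * sqnorm x"
proof -
  have "sqnorm (act a x) \<le> norm a * norm (ip x x) * norm (star a)"
    unfolding sqnorm_def ip_act_act
    by (meson mult_right_mono norm_ge_zero norm_mult_ineq order_trans)
  then show ?thesis by (simp add: sqnorm_def norm_star power2_eq_square algebra_simps)
qed

lemma sqnorm_tendsto_zero_add:
  assumes "(\<lambda>n. sqnorm (X n)) \<longlonglongrightarrow> 0" "(\<lambda>n. sqnorm (Y n)) \<longlonglongrightarrow> 0"
  shows "(\<lambda>n. sqnorm (X n + Y n)) \<longlonglongrightarrow> 0"
proof (rule tendsto_sandwich[rotated 3])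
  show "(\<lambda>n. 2 * sqnorm (X n) + 2 * sqnorm (Y n)) \<longlonglongrightarrow> 0"
    using tendsto_add[OF tendsto_mult_left[OF assms(1), of 2] tendsto_mult_left[OF assms(2), of 2]]
    by simp
  show "(\<lambda>n. 0::real) \<longlonglongrightarrow> 0" by simp
qed (auto simp: sqnorm_add)

lemma sqnorm_tendsto_zero_diff:
  assumes "(\<lambda>n. sqnorm (X n)) \<longlonglongrightarrow> 0" "(\<lambda>n. sqnorm (Y n)) \<longlonglongrightarrow> 0"
  shows "(\<lambda>n. sqnorm (X n - Y n)) \<longlonglongrightarrow> 0"
  using sqnorm_tendsto_zero_add[of X "\<lambda>n. - Y n"] assms by (simp add: sqnorm_minus)

lemma sqnorm_tendsto_zero_act:
  assumes "(\<lambda>n. sqnorm (X n)) \<longlonglongrightarrow> 0"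
  shows "(\<lambda>n. sqnorm (act a (X n))) \<longlonglongrightarrow> 0"
proof (rule tendsto_sandwich[rotated 3])
  show "(\<lambda>n. (norm a)\<^sup>2 * sqnorm (X n)) \<longlonglongrightarrow> 0"
    using tendsto_mult_left[OF assms, of "(norm a)\<^sup>2"] by simp
  show "(\<lambda>n. 0::real) \<longlonglongrightarrow> 0" by simp
qed (auto simp: sqnorm_act)

section \<open>Isometries preserve the inner product\<close>

text \<open>
  Blecher's theorem. Applying the isometry property to \<open>a x\<close> for all \<open>a\<close> shows that
  \<open>\<langle>Tx, Tx\<rangle>\<close> and \<open>\<langle>x, x\<rangle>\<close> have conjugates of equal norm, hence are equal.
  Polarization does the rest: the sums \<open>\<langle>x, y\<rangle> + \<langle>y, x\<rangle>\<close> are preserved, and replacing \<open>y\<close>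
  by \<open>\<i> y\<close> the differences are preserved too.
\<close>
lemma isometry_preserves_ip:
  assumes lin: "\<And>a b x y. T (act a x + act b y) = act a (T x) + act b (T y)"
    and iso: "\<And>x. module_norm ip (T x) = module_norm ip x"
  shows "ip (T x) (T y) = ip x y"
proof -
  have Tact: "T (act a x) = act a (T x)" for a x using lin[of a x 0 x] by simp
  have Tadd: "T (x + y) = T x + T y" for x y using lin[of 1 x 1 y] by (simp add: act_one)
  have diag: "ip (T x) (T x) = ip x x" for x
  proof (rule nonneg_eq_if_conjugate_norms_eq[OF ip_nonneg ip_nonneg])
    fix a
    have "sqnorm (T (act a x)) = sqnorm (act a x)"
      using iso[of "act a x"] by (simp add: module_norm_eq_sqrt)
    then show "norm (a * ip (T x) (T x) * star a) = norm (a * ip x x * star a)"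
      by (simp add: Tact sqnorm_def ip_act_act)
  qed
  have re: "ip (T u) (T v) + ip (T v) (T u) = ip u v + ip v u" for u v
    using diag[of "u + v"] diag[of u] diag[of v] by (simp add: Tadd ip_add_left ip_add_right algebra_simps)
  have "scaleC \<i> (ip (T y) (T x)) - scaleC \<i> (ip (T x) (T y)) = scaleC \<i> (ip y x) - scaleC \<i> (ip x y)"
    using re[of "act (scaleC \<i> 1) y" x]
    by (simp add: Tact ip_act_left ip_act_right star_scaleC mult_scaleC_left mult_scaleC_right
        scaleC_minus_left)
  then have "scaleC \<i> (ip (T y) (T x) - ip (T x) (T y)) = scaleC \<i> (ip y x - ip x y)"
    by (simp add: scaleC_diff_right)
  then have "scaleC (- \<i>) (scaleC \<i> (ip (T y) (T x) - ip (T x) (T y)))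
      = scaleC (- \<i>) (scaleC \<i> (ip y x - ip x y))" by simp
  then have im: "ip (T y) (T x) - ip (T x) (T y) = ip y x - ip x y"
    by (simp add: scaleC_scaleC)
  have "2 *\<^sub>R ip (T x) (T y) = (ip (T x) (T y) + ip (T y) (T x)) - (ip (T y) (T x) - ip (T x) (T y))"
    by (simp add: scaleR_2)
  also have "\<dots> = 2 *\<^sub>R ip x y" by (simp only: re im) (simp add: scaleR_2)
  finally have "2 *\<^sub>R ip (T x) (T y) = 2 *\<^sub>R ip x y" .
  then show ?thesis by simp
qed

section \<open>The residuals of the Kaczmarz algorithm\<close>

definition reject :: "'h \<Rightarrow> 'h \<Rightarrow> 'h" where
  "reject u x = x - act (ip x u) u"

text \<open>
  The index counts the vectors already used, so the sequence starts at \<open>x\<close> itself. With this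
  convention residuals along \<open>e\<close> relate to residuals along the shifted sequence by merely
  splitting off the first step.
\<close>
primrec residual :: "(nat \<Rightarrow> 'h) \<Rightarrow> 'h \<Rightarrow> nat \<Rightarrow> 'h" where
  "residual e x 0 = x"
| "residual e x (Suc n) = reject (e n) (residual e x n)"

lemma kaczmarz_residual: "x - kaczmarz act ip e x n = residual e x (Suc n)"
proof (induction n)
  case (Suc n)
  have "x - kaczmarz act ip e x (Suc n) = reject (e (Suc n)) (x - kaczmarz act ip e x n)"
    by (simp add: reject_def)
  then show ?case by (simp only: Suc residual.simps)
qed (simp add: reject_def)

lemma effective_iff_residuals_vanish:
  assumes "\<And>n. ip (e n) (e n) = 1"
  shows "effective act ip e \<longleftrightarrow> (\<forall>x. (\<lambda>n. sqnorm (residual e x n)) \<longlonglongrightarrow> 0)"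
proof -
  have "sqnorm (kaczmarz act ip e x n - x) = sqnorm (residual e x (Suc n))" for x n
    using sqnorm_minus[of "x - kaczmarz act ip e x n"]
    unfolding kaczmarz_residual[symmetric] by simp
  then show ?thesis
    using assms unfolding effective_def module_tendsto_iff_sqnorm
    by (simp only: filterlim_sequentially_Suc[of "\<lambda>n. sqnorm (residual e _ n)"]) simp
qed

lemma residual_add: "residual e (x + y) n = residual e x n + residual e y n"
  by (induction n) (auto simp: reject_def ip_add_left act_add_left)

lemma residual_act: "residual e (act a x) n = act a (residual e x n)"
  by (induction n) (auto simp: reject_def ip_act_left act_diff_right act_act)

lemma residual_zero: "residual e 0 n = 0"
  by (induction n) (auto simp: reject_def)

lemma residual_minus: "residual e (- x) n = - residual e x n"
  using residual_add[of e x "- x" n] by (simp add: residual_zero eq_neg_iff_add_eq_0 add.commute)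

lemma residual_diff: "residual e (x - y) n = residual e x n - residual e y n"
  using residual_add[of e x "- y" n] by (simp add: residual_minus)

lemma residual_Suc_shift:
  "residual e x (Suc n) = residual (\<lambda>i. e (Suc i)) (reject (e 0) x) n"
  by (induction n) auto

text \<open>
  Pythagoras for the decomposition of \<open>x\<close> along \<open>u\<close>.
\<close>
lemma ip_reject:
  assumes "ip u u = 1"
  shows "ip x x = ip (reject u x) (reject u x) + ip x u * star (ip x u)"
proof -
  have "ip u x = star (ip x u)" by (rule ip_commute)
  then show ?thesis
    by (simp add: reject_def ip_diff_left ip_diff_right ip_act_left ip_act_right assms)
qed

text \<open>
  A Pythagoras step splits the inner square of a residual into that of the next residual and
  \<open>b b\<^sup>*\<close> with \<open>b\<close> in the algebra. The latter is the inner square of \<open>b u\<close>, so both parts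
  are positive and the norm is monotone.
\<close>
lemma sqnorm_residual_le:
  assumes "\<And>n. ip (e n) (e n) = 1"
  shows "sqnorm (residual e x n) \<le> sqnorm x"
proof (induction n)
  case (Suc n)
  let ?r = "residual e x n" and ?u = "e n"
  have "ip (act (ip ?r ?u) ?u) (act (ip ?r ?u) ?u) = ip ?r ?u * star (ip ?r ?u)"
    by (simp add: ip_act_act assms)
  then have "cstar_nonneg (ip ?r ?u * star (ip ?r ?u))" by (metis ip_nonneg)
  then have "sqnorm (reject ?u ?r) \<le> sqnorm ?r"
    unfolding sqnorm_def ip_reject[OF assms, of ?r n] by (intro nonneg_norm_mono ip_nonneg)
  then show ?case using Suc by simp
qed simp

text \<open>
  The residual maps are \<open>A\<close>-linear contractions, so pointwise convergence to zero passes from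
  the generators to their span and from there to its closure.
\<close>
lemma residuals_vanish_if_on_generators:
  assumes gen: "generates act ip e" and unit: "\<And>n. ip (e n) (e n) = 1"
    and van: "\<And>k. (\<lambda>n. sqnorm (residual e (e k) n)) \<longlonglongrightarrow> 0"
  shows "(\<lambda>n. sqnorm (residual e x n)) \<longlonglongrightarrow> 0"
proof (rule LIMSEQ_I)
  fix \<epsilon> :: real assume \<epsilon>: "0 < \<epsilon>"
  have "sqrt (\<epsilon> / 4) > 0" using \<epsilon> by simp
  then obtain F a where F: "finite F" "module_norm ip (x - (\<Sum>n\<in>F. act (a n) (e n))) < sqrt (\<epsilon> / 4)"
    using gen unfolding generates_def by meson
  define s where "s = (\<Sum>n\<in>F. act (a n) (e n))"
  have near: "sqnorm (x - s) < \<epsilon> / 4" using F by (simp add: module_norm_eq_sqrt s_def)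
  have "(\<lambda>n. sqnorm (residual e s n)) \<longlonglongrightarrow> 0"
    unfolding s_def using F(1)
  proof (induction F)
    case (insert k F)
    then show ?case
      using sqnorm_tendsto_zero_add[OF sqnorm_tendsto_zero_act[OF van]]
      by (simp add: residual_add residual_act)
  qed (simp add: residual_zero)
  then obtain N where N: "\<And>n. n \<ge> N \<Longrightarrow> sqnorm (residual e s n) < \<epsilon> / 4"
    using \<epsilon> unfolding LIMSEQ_iff by (metis abs_of_nonneg diff_zero real_norm_def sqnorm_nonneg
        zero_less_divide_iff zero_less_numeral)
  have "sqnorm (residual e x n) < \<epsilon>" if "n \<ge> N" for n
  proof -
    have "sqnorm (residual e x n) = sqnorm (residual e (x - s) n + residual e s n)"
      by (simp add: residual_diff)
    also have "\<dots> \<le> 2 * sqnorm (residual e (x - s) n) + 2 * sqnorm (residual e s n)"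
      by (rule sqnorm_add)
    also have "\<dots> < \<epsilon>"
      using sqnorm_residual_le[of e "x - s" n, OF unit] near N[OF that] by linarith
    finally show ?thesis .
  qed
  then show "\<exists>no. \<forall>n\<ge>no. norm (sqnorm (residual e x n) - 0) < \<epsilon>" by auto
qed

section \<open>Residuals of a stationary sequence\<close>

lemma residual_intertwine:
  assumes "\<And>a b x y. T (act a x + act b y) = act a (T x) + act b (T y)"
    and "\<And>x y. ip (T x) (T y) = ip x y"
  shows "residual (\<lambda>i. T (e i)) (T x) n = T (residual e x n)"
proof (induction n)
  case (Suc n)
  have "T (reject u y) = reject (T u) (T y)" for u y
    using assms(1)[of 1 y "- ip y u" u] by (simp add: reject_def act_one act_minus_left assms(2))
  then show ?case using Suc by simp
qed simp

text \<open>
  The vector \<open>Tx\<close> first loses its component along \<open>e\<^sub>0\<close>. From then on only \<open>e\<^sub>1, e\<^sub>2, \<dots>\<close>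
  are used; on \<open>Tx\<close> these act as \<open>e\<^sub>0, e\<^sub>1, \<dots>\<close> act on \<open>x\<close>, and the removed component
  contributes a multiple of the residual of \<open>e\<^sub>0\<close> along the shifted sequence.
\<close>
lemma residual_isometry_step:
  assumes "\<And>a b x y. T (act a x + act b y) = act a (T x) + act b (T y)"
    and "\<And>x y. ip (T x) (T y) = ip x y" and Te: "\<And>n. T (e n) = e (Suc n)"
  shows "residual e (T x) (Suc n) =
    T (residual e x n) - act (ip (T x) (e 0)) (residual (\<lambda>i. e (Suc i)) (e 0) n)"
proof -
  have "residual (\<lambda>i. e (Suc i)) (T x) n = T (residual e x n)"
    using residual_intertwine[of T e x n, OF assms(1,2)] by (simp add: Te)
  then show ?thesis
    unfolding residual_Suc_shift by (simp add: reject_def residual_diff residual_act)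
qed

text \<open>
  Write \<open>r\<^sub>n x\<close> for the residuals and \<open>h\<^sub>n\<close> for the residual of \<open>e\<^sub>0\<close> along the shifted
  sequence. The recursion \<open>r\<^sub>n\<^sub>+\<^sub>1 e\<^sub>k\<^sub>+\<^sub>1 = T (r\<^sub>n e\<^sub>k) - \<langle>e\<^sub>k\<^sub>+\<^sub>1, e\<^sub>0\<rangle> h\<^sub>n\<close> can be solved
  for its last term, which gives one direction. For the other, induct on \<open>k\<close>, starting from
  \<open>r\<^sub>n e\<^sub>0 = 0\<close> for \<open>n \<ge> 1\<close>.
\<close>
lemma residuals_vanish_iff_defect:
  assumes lin: "\<And>a b x y. T (act a x + act b y) = act a (T x) + act b (T y)"
    and iso: "\<And>x y. ip (T x) (T y) = ip x y" and Te: "\<And>n. T (e n) = e (Suc n)"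
    and unit: "ip (e 0) (e 0) = 1"
  shows "(\<forall>k. (\<lambda>n. sqnorm (residual e (e k) n)) \<longlonglongrightarrow> 0) \<longleftrightarrow>
    (\<forall>k>0. (\<lambda>n. sqnorm (act (ip (e k) (e 0)) (residual (\<lambda>i. e (Suc i)) (e 0) n))) \<longlonglongrightarrow> 0)"
    (is "?L \<longleftrightarrow> ?R")
proof -
  let ?h = "\<lambda>n. residual (\<lambda>i. e (Suc i)) (e 0) n"
  have step: "residual e (e (Suc k)) (Suc n) = T (residual e (e k) n) - act (ip (e (Suc k)) (e 0)) (?h n)"
    for k n using residual_isometry_step[of T e "e k" n, OF lin iso Te] by (simp add: Te)
  have T: "sqnorm (T x) = sqnorm x" for x by (simp add: sqnorm_def iso)
  show ?thesis
  proof
    assume L: ?L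
    show ?R
    proof (intro allI impI)
      fix k :: nat assume "k > 0"
      then obtain j where k: "k = Suc j" using gr0_conv_Suc by auto
      have "act (ip (e k) (e 0)) (?h n) = T (residual e (e j) n) - residual e (e k) (Suc n)" for n
        by (simp only: step k) simp
      moreover have "(\<lambda>n. sqnorm (T (residual e (e j) n) - residual e (e k) (Suc n))) \<longlonglongrightarrow> 0"
        using L by (intro sqnorm_tendsto_zero_diff LIMSEQ_Suc) (simp_all add: T)
      ultimately show "(\<lambda>n. sqnorm (act (ip (e k) (e 0)) (?h n))) \<longlonglongrightarrow> 0" by simp
    qed
  next
    assume R: ?R
    show ?L
    proof
      fix k show "(\<lambda>n. sqnorm (residual e (e k) n)) \<longlonglongrightarrow> 0"
      proof (induction k)
        case 0
        have "residual e (e 0) (Suc n) = 0" for n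
          unfolding residual_Suc_shift by (simp add: reject_def unit act_one residual_zero)
        then show ?case by (subst filterlim_sequentially_Suc[symmetric]) (simp del: residual.simps)
      next
        case (Suc k)
        have "(\<lambda>n. sqnorm (residual e (e (Suc k)) (Suc n))) \<longlonglongrightarrow> 0"
          unfolding step using R Suc by (intro sqnorm_tendsto_zero_diff) (simp_all add: T)
        then show ?case by (rule LIMSEQ_imp_Suc)
      qed
    qed
  qed
qed

text \<open>
  For the coefficients \<open>d\<^sub>n\<close> that the algorithm produces, \<open>d\<^sub>n\<^sub>+\<^sub>1\<close> is minus the inner product of
  \<open>\<Sum>j\<le>n. d\<^sub>j e\<^sub>j\<close> with \<open>e\<^sub>n\<^sub>+\<^sub>1\<close>. As the inner products depend only on the difference of the
  indices, this is the recursion that defines \<open>c\<close>.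
\<close>
lemma defect_expansion:
  assumes toep: "\<And>i j. ip (e (Suc i)) (e (Suc j)) = ip (e i) (e j)"
    and c0: "c 0 = 1" and c: "\<And>n. n \<ge> 1 \<Longrightarrow> c n = - (\<Sum>j<n. c j * ip (e 0) (e (n - j)))"
  shows "residual (\<lambda>i. e (Suc i)) (e 0) n = (\<Sum>j\<le>n. act (c j) (e j))"
    and "ip (residual (\<lambda>i. e (Suc i)) (e 0) n) (e (Suc n)) = - c (Suc n)"
proof -
  have shift: "ip (e j) (e (j + m)) = ip (e 0) (e m)" for j m
    by (induction j) (auto simp: toep)
  have coeff: "ip (\<Sum>j\<le>n. act (c j) (e j)) (e (Suc n)) = - c (Suc n)" for n
  proof -
    have "ip (\<Sum>j\<le>n. act (c j) (e j)) (e (Suc n)) = (\<Sum>j\<le>n. c j * ip (e j) (e (Suc n)))"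
      by (simp add: ip_sum_left ip_act_left)
    also have "\<dots> = (\<Sum>j\<le>n. c j * ip (e 0) (e (Suc n - j)))"
      by (intro sum.cong refl) (use shift in \<open>metis atMost_iff le_SucI le_add_diff_inverse\<close>)
    finally show ?thesis using c[of "Suc n"] by (simp add: lessThan_Suc_atMost)
  qed
  show *: "residual (\<lambda>i. e (Suc i)) (e 0) n = (\<Sum>j\<le>n. act (c j) (e j))"
  proof (induction n)
    case (Suc n)
    then show ?case by (simp add: reject_def coeff act_minus_left)
  qed (simp add: c0 act_one)
  show "ip (residual (\<lambda>i. e (Suc i)) (e 0) n) (e (Suc n)) = - c (Suc n)"
    using coeff by (simp add: *)
qed

text \<open>
  By Pythagoras, step \<open>n\<close> removes exactly \<open>c\<^sub>n c\<^sub>n\<^sup>*\<close> from \<open>\<langle>e\<^sub>0, e\<^sub>0\<rangle> = 1\<close>.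
\<close>
lemma ip_defect:
  assumes toep: "\<And>i j. ip (e (Suc i)) (e (Suc j)) = ip (e i) (e j)" and unit: "\<And>n. ip (e n) (e n) = 1"
    and c: "c 0 = 1" "\<And>n. n \<ge> 1 \<Longrightarrow> c n = - (\<Sum>j<n. c j * ip (e 0) (e (n - j)))"
  shows "ip (residual (\<lambda>i. e (Suc i)) (e 0) n) (residual (\<lambda>i. e (Suc i)) (e 0) n)
    = 1 - (\<Sum>j = 1..n. c j * star (c j))"
proof (induction n)
  case (Suc n)
  let ?h = "residual (\<lambda>i. e (Suc i)) (e 0)"
  have "ip (?h n) (?h n) = ip (?h (Suc n)) (?h (Suc n)) + c (Suc n) * star (c (Suc n))"
    using ip_reject[OF unit, of "?h n" "Suc n"] defect_expansion(2)[OF toep c, of n]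
    by (simp add: star_minus)
  then show ?case using Suc by (simp add: algebra_simps)
qed (simp add: unit)

end

theorem theorem4p3:
  fixes scale :: "complex \<Rightarrow> 'h::ab_group_add \<Rightarrow> 'h"
    and act :: "'a::unital_cstar_algebra \<Rightarrow> 'h \<Rightarrow> 'h"
    and ip :: "'h \<Rightarrow> 'h \<Rightarrow> 'a"
    and e :: "nat \<Rightarrow> 'h"
    and c :: "nat \<Rightarrow> 'a"
  assumes "hilbert_module scale act ip"
    and "stationary act ip e"
    and "generates act ip e"
    and "ip (e 0) (e 0) = 1"
    and "c 0 = 1"
    and "\<And>n. n \<ge> 1 \<Longrightarrow> c n = - (\<Sum>j<n. c j * ip (e 0) (e (n - j)))"
  shows "effective act ip e \<longleftrightarrow>
    (\<forall>k>0. (\<lambda>N. ip (e k) (e 0) * (\<Sum>n = 1..N. c n * star (c n)) * ip (e 0) (e k))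
             \<longlonglongrightarrow> ip (e k) (e 0) * ip (e 0) (e k))"
proof -
  interpret hilbert_module scale act ip by (rule assms(1))
  obtain T where lin: "\<And>a b x y. T (act a x + act b y) = act a (T x) + act b (T y)"
    and norm: "\<And>x. module_norm ip (T x) = module_norm ip x"
    and orbit: "\<And>n. (T ^^ n) (e 0) = e n"
    using assms(2) unfolding stationary_def by blast
  have iso: "ip (T x) (T y) = ip x y" for x y using isometry_preserves_ip[of T, OF lin norm] .
  have Te: "T (e n) = e (Suc n)" for n using orbit[of n] orbit[of "Suc n"] by simp
  have toep: "ip (e (Suc i)) (e (Suc j)) = ip (e i) (e j)" for i j by (simp add: iso flip: Te)
  have unit: "ip (e n) (e n) = 1" for n by (induction n) (auto simp: assms(4) toep)
  let ?h = "residual (\<lambda>i. e (Suc i)) (e 0)"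
  have ip_h: "ip (?h N) (?h N) = 1 - (\<Sum>n = 1..N. c n * star (c n))" for N
    using ip_defect[of e c, OF toep unit assms(5,6)] .
  have defect: "sqnorm (act (ip (e k) (e 0)) (?h N)) =
      norm (ip (e k) (e 0) * (\<Sum>n = 1..N. c n * star (c n)) * ip (e 0) (e k)
        - ip (e k) (e 0) * ip (e 0) (e k))" for k N
    unfolding sqnorm_def ip_act_act ip_commute[of "e 0" "e k"]
    by (subst norm_minus_commute) (simp add: ip_h algebra_simps)
  have "effective act ip e \<longleftrightarrow> (\<forall>k. (\<lambda>n. sqnorm (residual e (e k) n)) \<longlonglongrightarrow> 0)"
    unfolding effective_iff_residuals_vanish[OF unit]
    using residuals_vanish_if_on_generators[OF assms(3) unit] by blast
  also have "\<dots> \<longleftrightarrow> (\<forall>k>0. (\<lambda>N. sqnorm (act (ip (e k) (e 0)) (?h N))) \<longlonglongrightarrow> 0)"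
    by (rule residuals_vanish_iff_defect[of T e, OF lin iso Te assms(4)])
  finally show ?thesis
    unfolding defect tendsto_norm_zero_iff by (simp only: LIM_zero_iff)
qed

end
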